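(* Let $\ell\ge 1$ be a fixed integer. As $x\to\infty$, $$q_\ell(x)=\frac{\sqrt{2x}}{\log x}\left(1+O_\ell(x^{-1/2})\right).$$ In particular, $q_\ell(x)\sim \sqrt{2x}/\log x$ as $x\to\infty$.
   Context: For an integer $\ell\ge1$ and $n\ge 1$ put $L_n^{(\ell)}=\frac{n(\ell(n-1)+2)}{2}$ and $h_n^{(\ell)}=L_{n+1}^{(\ell)}-L_n^{(\ell)}=1+\ell n$. For real $x$ let $\nu_\ell(x)=\frac{\sqrt{8\ell x+(\ell-2)^2}+\ell-2}{2\ell}$ (the positive real solution $t$ of $\frac{t(\ell(t-1)+2)}{2}=x$) and $n_x^{(\ell)}=\lceil \nu_\ell(x)\rceil$. Thus with $n=n_x^{(\ell)}$ one has $L_{n-1}^{(\ell)}<x\le L_n^{(\ell)}$. For $x\ge L_2^{(\ell)}$ define $$q_\ell(x)=\frac{h_{n_x^{(\ell)}-1}^{(\ell)}}{\sqrt{\ell}\,\log L_{n_x^{(\ell)}}^{(\ell)}}.$$ The implied constant in $O_\ell$ may depend on $\ell$ but not on $x$. *)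

theory Defs
  imports Complex_Main "HOL-Library.Landau_Symbols"
begin

definition L :: "nat \<Rightarrow> nat \<Rightarrow> real" where
  "L l n = real n * (real l * (real n - 1) + 2) / 2"

definition h :: "nat \<Rightarrow> nat \<Rightarrow> real" where
  "h l n = L l (n + 1) - L l n"

definition nu :: "nat \<Rightarrow> real \<Rightarrow> real" where
  "nu l x = (sqrt (8 * real l * x + (real l - 2)\<^sup>2) + real l - 2) / (2 * real l)"

(* The ceiling is positive for l >= 1 and x > 0, so converting it to nat loses nothing there. *)
definition n_idx :: "nat \<Rightarrow> real \<Rightarrow> nat" where
  "n_idx l x = nat \<lceil>nu l x\<rceil>"

(* Only meaningful for x >= L l 2; then n_idx l x >= 2, so the subtraction on nat
   is not truncated, and the logarithm is positive. *)
definition q :: "nat \<Rightarrow> real \<Rightarrow> real" where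
  "q l x = h l (n_idx l x - 1) / (sqrt (real l) * ln (L l (n_idx l x)))"

lemma h_eq: "h l n = 1 + real l * real n"
  by (simp add: h_def L_def field_simps)

lemma nu_pos:
  assumes "l \<ge> 1" "x > 0"
  shows "nu l x > 0"
proof -
  have "sqrt ((real l - 2)\<^sup>2) < sqrt (8 * real l * x + (real l - 2)\<^sup>2)"
    using assms by (intro real_sqrt_less_mono) simp
  then have "\<bar>real l - 2\<bar> < sqrt (8 * real l * x + (real l - 2)\<^sup>2)"
    by simp
  then show ?thesis
    using assms unfolding nu_def by (intro divide_pos_pos) auto
qed

lemma nu_solves:
  assumes "l \<ge> 1" "x > 0"
  shows "nu l x * (real l * (nu l x - 1) + 2) / 2 = x"
proof -
  define s where "s = sqrt (8 * real l * x + (real l - 2)\<^sup>2)"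
  have s: "s\<^sup>2 = 8 * real l * x + (real l - 2)\<^sup>2"
    unfolding s_def using assms by simp
  have l: "real l > 0" using assms by simp
  have "nu l x * (real l * (nu l x - 1) + 2) / 2
      = (s\<^sup>2 - (real l - 2)\<^sup>2) / (8 * real l)"
    unfolding nu_def s_def[symmetric] using l by (simp add: field_simps power2_eq_square)
  then show ?thesis using s l by simp
qed

lemma poly_strict_mono:
  fixes s t :: real
  assumes "l \<ge> 1" "0 \<le> s" "s < t" "1 \<le> t"
  shows "s * (real l * (s - 1) + 2) < t * (real l * (t - 1) + 2)"
proof -
  have "t * (real l * (t - 1) + 2) - s * (real l * (s - 1) + 2)
      = (t - s) * (real l * (t + s - 1) + 2)"
    by (simp add: algebra_simps)
  moreover have "real l * (t + s - 1) \<ge> 0"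
    using assms by (intro mult_nonneg_nonneg) auto
  ultimately show ?thesis using assms
    by (smt (verit) mult_pos_pos)
qed

lemma n_idx_bracket:
  assumes l: "l \<ge> 1" and x: "x \<ge> 1"
  shows "n_idx l x \<ge> 1" "L l (n_idx l x - 1) < x" "x \<le> L l (n_idx l x)"
proof -
  define t where "t = nu l x"
  have t0: "t > 0" using nu_pos[of l x] l x by (simp add: t_def)
  have tx: "t * (real l * (t - 1) + 2) / 2 = x" using nu_solves[of l x] l x by (simp add: t_def)
  have t1: "t \<ge> 1"
    using poly_strict_mono[OF l, of t 1] t0 tx x by force
  show n1: "n_idx l x \<ge> 1" using t0 by (simp add: n_idx_def t_def[symmetric] le_nat_iff)
  have r: "real (n_idx l x) = of_int \<lceil>t\<rceil>" using t0 by (simp add: n_idx_def t_def[symmetric])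
  have up: "t \<le> real (n_idx l x)" and lo: "real (n_idx l x) - 1 < t"
    unfolding r by linarith+
  show "L l (n_idx l x - 1) < x"
    using poly_strict_mono[OF l, of "real (n_idx l x - 1)" t] n1 lo t1 tx
    by (simp add: L_def of_nat_diff)
  show "x \<le> L l (n_idx l x)"
    using poly_strict_mono[OF l, of t "real (n_idx l x)"] up t1 tx
    by (cases "t = real (n_idx l x)") (auto simp: L_def)
qed

end

theory Submission
  imports Defs
begin

text \<open>
  Write \<open>n = n_idx l x\<close> and \<open>H = h l (n - 1)\<close>. Since \<open>H\<^sup>2 = 2 l x + O(H)\<close> for \<open>x\<close> between
  \<open>L l (n - 1)\<close> and \<open>L l n\<close>, dividing by \<open>H + sqrt (2 l x)\<close> gives \<open>H = sqrt (2 l x) + O(1)\<close>.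
  The two bracketing values differ by \<open>H\<close>, so \<open>ln (L l n) - ln x \<le> H / x = O(x powr (-1/2))\<close>.
\<close>

text \<open>The factor \<open>3 * real l\<close> is a generous choice that leaves the error uniform
  in \<open>m\<close>, so it can serve for every \<open>x\<close> in the bracket.\<close>

lemma h_minus_sqrt_bound:
  assumes l: "l \<ge> 1" and x: "L l m < x" "x \<le> L l (m + 1)" and x0: "x > 0"
  shows "\<bar>h l m - sqrt (2 * real l * x)\<bar> \<le> 3 * real l"
proof -
  define H S where "H = h l m" and "S = sqrt (2 * real l * x)"
  have l1: "real l \<ge> 1" using l by simp
  have H: "H = 1 + real l * real m" by (simp add: H_def h_eq)
  have H1: "H \<ge> 1" unfolding H by simp
  have S0: "S \<ge> 0" and S2: "S\<^sup>2 = 2 * real l * x" using x0 by (simp_all add: S_def)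
  have H2: "H\<^sup>2 = 1 + 2 * (real l * real m) + real l * (real l * (real m * real m))"
    unfolding H by (simp add: power2_eq_square algebra_simps)
  have "2 * real l * L l m \<le> S\<^sup>2" "S\<^sup>2 \<le> 2 * real l * L l (m + 1)"
    unfolding S2 using x l by (auto intro!: mult_left_mono)
  then have lo: "real l * (real l * (real m * real m)) - real l * (real l * real m)
        + 2 * (real l * real m) \<le> S\<^sup>2"
    and up: "S\<^sup>2 \<le> real l * (real l * (real m * real m)) + real l * (real l * real m)
        + 2 * (real l * real m) + 2 * real l"
    by (simp_all add: L_def algebra_simps)
  have "real l * (real l * real m) \<ge> 0" by simp
  moreover have "3 * real l * H = 3 * real l + 3 * (real l * (real l * real m))"
    unfolding H by (simp add: algebra_simps)
  \<comment> \<open>With \<open>l\<close>, \<open>m\<close> read as reals, \<open>lo\<close> gives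
    \<open>H^2 - S^2 \<le> 1 + l^2 m\<close> and \<open>up\<close> gives
    \<open>S^2 - H^2 \<le> l^2 m + 2 l - 1\<close>; both are at most
    \<open>3 l + 3 l^2 m\<close>.\<close>
  ultimately have "\<bar>H\<^sup>2 - S\<^sup>2\<bar> \<le> 3 * real l * H"
    using lo up l1 unfolding H2 by linarith
  moreover have "\<bar>H\<^sup>2 - S\<^sup>2\<bar> = \<bar>H - S\<bar> * (H + S)"
    using H1 S0 by (simp add: power2_eq_square square_diff_square_factored abs_mult)
  moreover have "\<bar>H - S\<bar> * H \<le> \<bar>H - S\<bar> * (H + S)"
    using S0 by (intro mult_left_mono) auto
  ultimately have "\<bar>H - S\<bar> * H \<le> 3 * real l * H" by linarith
  then show ?thesis using H1 unfolding H_def S_def by simp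
qed

text \<open>The ratio factors as \<open>(1 + a) * (1 - b)\<close> with \<open>a\<close> of size at
  most \<open>3 l / r\<close> and \<open>b\<close> at most \<open>5 l / r\<close>, where
  \<open>r = sqrt x\<close>. The constant collects \<open>3 l + 5 l\<close> and the product
  \<open>3 l * 5 l\<close>.\<close>

lemma q_relative_error_bound:
  assumes l: "l \<ge> 1" and x: "x \<ge> 3"
  shows "\<bar>q l x * ln x / sqrt (2 * x) - 1\<bar>
           \<le> (8 * real l + 15 * (real l)\<^sup>2) * x powr (-1/2)"
proof -
  define n m where "n = n_idx l x" and "m = n_idx l x - 1"
  define H S r where "H = h l m" and "S = sqrt (2 * real l * x)" and "r = sqrt x"
  have l1: "real l \<ge> 1" using l by simp
  have br: "n \<ge> 1" "L l m < x" "x \<le> L l n" and n: "n = m + 1"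
    using n_idx_bracket[OF l, of x] x by (auto simp: n_def m_def)
  have r1: "r \<ge> 1" and r2: "r * r = x" using x by (simp_all add: r_def)
  have pw: "x powr (-1/2) = 1 / r"
    using x powr_minus_divide[of x "1/2"] by (simp add: r_def powr_half_sqrt)
  have Sr: "S = sqrt (2 * real l) * r" by (simp add: S_def r_def real_sqrt_mult)
  \<comment> \<open>These bounds allow \<open>S\<close> to be traded for \<open>r\<close> up to a
    factor depending on \<open>l\<close> only.\<close>
  have "sqrt (2 * real l) \<ge> 1" "sqrt (2 * real l) \<le> 2 * real l"
    using l1 by (auto intro!: real_le_lsqrt simp: power2_eq_square)
  then have Slo: "S \<ge> r" and Sup: "S \<le> 2 * real l * r"
    unfolding Sr using r1 by (auto intro: mult_right_mono)
  have HS: "\<bar>H - S\<bar> \<le> 3 * real l"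
    using h_minus_sqrt_bound[OF l, of m x] br n x by (simp add: H_def S_def)
  define a where "a = H / S - 1"
  have "\<bar>a\<bar> = \<bar>H - S\<bar> / S" using Slo r1
    by (simp add: a_def diff_divide_distrib[symmetric] abs_divide divide_simps)
  also have "\<dots> \<le> 3 * real l / r"
    using HS Slo r1 by (intro frac_le) auto
  finally have a: "\<bar>a\<bar> \<le> 3 * real l / r" .
  define b where "b = 1 - ln x / ln (L l n)"
  have "ln (3::real) \<ge> 1"
    using exp_le by (subst ln_ge_iff) auto
  then have lnx: "ln x \<ge> 1" using x by (smt (verit) ln_le_cancel_iff)
  have lnL: "ln (L l n) \<ge> ln x" using br x by simp
  have "H \<le> 2 * real l * r + 3 * real l * r"
    using HS Sup mult_left_mono[OF r1, of "3 * real l"] by linarith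
  then have Hr: "H \<le> 5 * real l * r" by (simp add: algebra_simps)
  have "ln (L l n) - ln x = ln (L l n / x)" using br x by (simp add: ln_div)
  also have "\<dots> \<le> L l n / x - 1" using br x by (intro ln_le_minus_one) auto
  also have "\<dots> = (L l n - x) / x" using x by (simp add: field_simps)
  \<comment> \<open>Since \<open>x\<close> lies above \<open>L l m\<close>, the gap
    \<open>L l n - x\<close> is below the full step \<open>H\<close>.\<close>
  also have "\<dots> \<le> H / x" using br x n by (intro divide_right_mono) (auto simp: H_def h_def)
  also have "\<dots> \<le> 5 * real l * r / (r * r)"
    unfolding r2 using Hr x by (intro divide_right_mono) auto
  also have "\<dots> = 5 * real l / r" using r1 by simp
  finally have d: "ln (L l n) - ln x \<le> 5 * real l / r" .
  have "b = (ln (L l n) - ln x) / ln (L l n)"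
    using lnL lnx by (simp add: b_def diff_divide_distrib)
  also have "\<bar>\<dots>\<bar> \<le> (ln (L l n) - ln x) / 1"
    using lnL lnx by (simp only: abs_divide) (intro frac_le, auto)
  finally have b: "\<bar>b\<bar> \<le> 5 * real l / r" using d by simp
  have "\<bar>a * b\<bar> \<le> (3 * real l / r) * (5 * real l / r)"
    unfolding abs_mult using a b r1 by (intro mult_mono) auto
  also have "\<dots> = 15 * (real l)\<^sup>2 / r / r" by (simp add: power2_eq_square)
  also have "\<dots> \<le> 15 * (real l)\<^sup>2 / r / 1" using r1 by (intro frac_le) auto
  finally have ab: "\<bar>a * b\<bar> \<le> 15 * (real l)\<^sup>2 / r" by simp
  \<comment> \<open>The \<open>sqrt (real l)\<close> in the definition of \<open>q\<close> merges
    with \<open>sqrt (2 * x)\<close> into \<open>S\<close>.\<close>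
  have "q l x * ln x / sqrt (2 * x) = (H / S) * (ln x / ln (L l n))"
    by (simp add: q_def H_def S_def n_def m_def real_sqrt_mult)
  also have "\<dots> = (1 + a) * (1 - b)"
    by (simp add: a_def b_def)
  also have "\<dots> - 1 = a - b - a * b"
    by (simp add: algebra_simps)
  also have "\<bar>\<dots>\<bar> \<le> 3 * real l / r + 5 * real l / r + 15 * (real l)\<^sup>2 / r"
    using a b ab by linarith
  also have "\<dots> = (8 * real l + 15 * (real l)\<^sup>2) * x powr (-1/2)"
    unfolding pw by (simp add: add_divide_distrib)
  finally show ?thesis .
qed

theorem lemma4p1:
  fixes l :: nat
  assumes "l \<ge> 1"
  shows "(\<exists>e :: real \<Rightarrow> real. e \<in> O[at_top](\<lambda>x. x powr (-1/2)) \<and>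
            (\<forall>x \<ge> L l 2. q l x = sqrt (2 * x) / ln x * (1 + e x)))
       \<and> asymp_equiv (q l) at_top (\<lambda>x. sqrt (2 * x) / ln x)"
proof -
  \<comment> \<open>Solving the claimed identity for the error makes it exact wherever
    \<open>ln x\<close> and \<open>sqrt (2 * x)\<close> are nonzero; only its size needs
    \<open>x \<ge> 3\<close>.\<close>
  define e where "e = (\<lambda>x. q l x * ln x / sqrt (2 * x) - 1)"
  define C where "C = 8 * real l + 15 * (real l)\<^sup>2"
  have bound: "eventually (\<lambda>x. norm (e x) \<le> C * x powr (-1/2)) at_top"
    using eventually_ge_at_top[of 3]
    by eventually_elim (use q_relative_error_bound[OF assms] in \<open>simp add: e_def C_def\<close>)
  then have O: "e \<in> O[at_top](\<lambda>x. x powr (-1/2))"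
    by (intro bigoI[of _ C]) simp
  have eq: "q l x = sqrt (2 * x) / ln x * (1 + e x)" if "x > 1" for x
    using that by (simp add: e_def)
  \<comment> \<open>Here \<open>L l 2 = l + 2\<close>, so the whole range of the claim lies where
    the identity holds.\<close>
  have L2: "L l 2 > 1" using assms by (simp add: L_def)
  have "((\<lambda>x::real. x powr (-1/2)) \<longlongrightarrow> 0) at_top"
    by (rule tendsto_neg_powr) (auto simp: filterlim_ident)
  then have "(e \<longlongrightarrow> 0) at_top"
    by (rule tendsto_0_le[where K = C]) (use bound in \<open>simp add: mult.commute\<close>)
  then have "((\<lambda>x. 1 + e x) \<longlongrightarrow> 1) at_top"
    by (auto intro!: tendsto_eq_intros)
  moreover have "eventually (\<lambda>x. 1 + e x = q l x / (sqrt (2 * x) / ln x)) at_top"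
    using eventually_gt_at_top[of 1] by eventually_elim (simp add: e_def)
  ultimately have "((\<lambda>x. q l x / (sqrt (2 * x) / ln x)) \<longlongrightarrow> 1) at_top"
    by (rule Lim_transform_eventually)
  then have "asymp_equiv (q l) at_top (\<lambda>x. sqrt (2 * x) / ln x)"
    by (rule asymp_equivI')
  moreover have "\<forall>x \<ge> L l 2. q l x = sqrt (2 * x) / ln x * (1 + e x)"
    using eq L2 by force
  ultimately show ?thesis using O by blast
qed

end
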